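(* Let $\mathcal{H}$ be a complex Hilbert space and let $T\in\mathbb{B}(\mathcal{H})$. Then $$\omega^{2}(T)\le \frac{1}{2}\left\|(T,T^{*})\right\|_{e}^{2}\le \frac{1}{2}\left\|TT^{*}+T^{*}T\right\|.$$
   Context: $\mathbb{B}(\mathcal{H})$ is the $C^*$-algebra of all bounded linear operators on $\mathcal{H}$, and $\|\cdot\|$ is the operator norm. The numerical radius is $\omega(T)=\sup_{\|x\|=1}|\langle Tx,x\rangle|$. For $T_1,T_2\in\mathbb{B}(\mathcal{H})$, the Euclidean operator norm of the pair is $\|(T_1,T_2)\|_e=\sup\{\|\lambda_1T_1+\lambda_2T_2\| : \lambda_1,\lambda_2\in\mathbb{C},\ |\lambda_1|^2+|\lambda_2|^2=1\}$. *)

theory Defs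
  imports "HOL-Analysis.Analysis"
begin

text \<open>
  A complex inner product space is presented over its underlying real inner product space, whose
  inner product is \<open>Re \<langle>x, y\<rangle>\<close>; hence \<open>\<langle>x, x\<rangle> = \<parallel>x\<parallel>\<^sup>2\<close> and positive definiteness come from
  \<^class>\<open>real_inner\<close>. The complex inner product is linear in its \<^emph>\<open>first\<close> argument.
\<close>

class complex_inner = real_inner +
  fixes scaleC :: "complex \<Rightarrow> 'a \<Rightarrow> 'a"  (infixr "*\<^sub>C" 75)
    and cinner :: "'a \<Rightarrow> 'a \<Rightarrow> complex"
  assumes scaleC_add_right: "a *\<^sub>C (x + y) = a *\<^sub>C x + a *\<^sub>C y"
    and scaleC_add_left: "(a + b) *\<^sub>C x = a *\<^sub>C x + b *\<^sub>C x"
    and scaleC_scaleC: "a *\<^sub>C (b *\<^sub>C x) = (a * b) *\<^sub>C x"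
    and scaleC_of_real: "complex_of_real r *\<^sub>C x = r *\<^sub>R x"
    and cinner_commute: "cinner x y = cnj (cinner y x)"
    and cinner_add_left: "cinner (x + y) z = cinner x z + cinner y z"
    and cinner_scaleC_left: "cinner (a *\<^sub>C x) y = a * cinner x y"
    and Re_cinner: "Re (cinner x y) = inner x y"

class chilbert_space = complex_inner + complete_space

lemma cinner_self: "cinner x x = complex_of_real ((norm x)\<^sup>2)"
  using cinner_commute[of x x]
  by (simp add: complex_eq_iff Re_cinner power2_norm_eq_inner)

lemma cinner_add_right: "cinner x (y + z) = cinner x y + cinner x z"
  by (metis cinner_add_left cinner_commute complex_cnj_add)

lemma cinner_scaleC_right: "cinner x (a *\<^sub>C y) = cnj a * cinner x y"
  by (metis cinner_commute cinner_scaleC_left complex_cnj_mult)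

lemma cinner_ext:
  assumes "\<And>z. cinner z x = cinner z y"
  shows "x = y"
  by (metis assms Re_cinner vector_eq_ldot)

instantiation complex :: chilbert_space
begin
definition scaleC_complex :: "complex \<Rightarrow> complex \<Rightarrow> complex"
  where "scaleC_complex a x = a * x"
definition cinner_complex :: "complex \<Rightarrow> complex \<Rightarrow> complex"
  where "cinner_complex x y = x * cnj y"
instance
  by standard
    (simp_all add: scaleC_complex_def cinner_complex_def algebra_simps inner_complex_def scaleR_conv_of_real)
end

text \<open>Membership in \<open>\<bbbB>(\<H>)\<close>; the operator norm on \<open>\<bbbB>(\<H>)\<close> is \<^const>\<open>onorm\<close>.\<close>

definition bounded_clinear :: "('a::complex_inner \<Rightarrow> 'a) \<Rightarrow> bool"
  where "bounded_clinear T \<longleftrightarrow> bounded_linear T \<and> (\<forall>c x. T (c *\<^sub>C x) = c *\<^sub>C T x)"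

definition cadjoint :: "('a::chilbert_space \<Rightarrow> 'a) \<Rightarrow> 'a \<Rightarrow> 'a"
  where "cadjoint T = (THE S. bounded_clinear S \<and> (\<forall>x y. cinner (T x) y = cinner x (S y)))"

text \<open>
  The supremum is taken in the nonnegative reals: inserting \<open>0\<close> is without effect unless there is
  no unit vector, i.e. in the zero space, where the numerical radius thereby becomes \<open>0\<close>.
\<close>

definition numerical_radius :: "('a::complex_inner \<Rightarrow> 'a) \<Rightarrow> real"
  where "numerical_radius T = Sup (insert 0 {cmod (cinner (T x) x) | x. norm x = 1})"

definition euclidean_opnorm :: "('a::complex_inner \<Rightarrow> 'a) \<Rightarrow> ('a \<Rightarrow> 'a) \<Rightarrow> real"
  where "euclidean_opnorm T\<^sub>1 T\<^sub>2 =
    Sup {onorm (\<lambda>x. l\<^sub>1 *\<^sub>C T\<^sub>1 x + l\<^sub>2 *\<^sub>C T\<^sub>2 x) | l\<^sub>1 l\<^sub>2. (cmod l\<^sub>1)\<^sup>2 + (cmod l\<^sub>2)\<^sup>2 = 1}"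

text \<open>Riesz representation, giving existence of the adjoint.\<close>

lemma riesz_real:
  fixes g :: "'a::{real_inner,complete_space} \<Rightarrow> real"
  assumes "bounded_linear g"
  obtains u where "\<And>x. g x = inner x u"
proof -
  interpret g: bounded_linear g by fact
  define J where "J x = inner x x / 2 - g x" for x
  obtain K where K: "\<And>x. norm (g x) \<le> norm x * K"
    using g.bounded by blast
  have lower: "- (K\<^sup>2 / 2) \<le> J x" for x
  proof -
    have "0 \<le> (norm x - K)\<^sup>2" by simp
    then have "norm x * K \<le> (norm x)\<^sup>2 / 2 + K\<^sup>2 / 2"
      by (simp add: power2_diff)
    moreover have "g x \<le> norm x * K" using K[of x] by simp
    ultimately show ?thesis
      unfolding J_def power2_norm_eq_inner by linarith
  qed
  define m where "m = (INF x. J x)"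
  have bdd: "bdd_below (range J)" using lower unfolding bdd_below_def by blast
  have m_le: "m \<le> J x" for x unfolding m_def by (rule cINF_lower[OF bdd]) simp
  have "\<exists>x. J x < m + inverse (real (Suc n))" for n
  proof -
    have "(INF x. J x) < m + inverse (real (Suc n))" unfolding m_def by simp
    then show ?thesis using cINF_less_iff[OF _ bdd] by auto
  qed
  then obtain X where X: "\<And>n. J (X n) < m + inverse (real (Suc n))" by metis
  have para: "(norm (x - y))\<^sup>2 / 4 = J x + J y - 2 * J ((1/2) *\<^sub>R (x + y))" for x y
    by (simp add: J_def power2_norm_eq_inner g.scaleR g.add inner_commute
        algebra_simps inner_add_left inner_diff_left inner_diff_right)
      (simp add: field_simps)
  have "Cauchy X"
  proof (rule metric_CauchyI)
    fix e :: real assume "0 < e"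
    then obtain N where N: "inverse (real (Suc N)) < e\<^sup>2 / 8"
      using reals_Archimedean[of "e\<^sup>2 / 8"] by auto
    have small: "J (X n) < m + e\<^sup>2 / 8" if "n \<ge> N" for n
    proof -
      have "inverse (real (Suc n)) \<le> inverse (real (Suc N))" using that by (simp add: field_simps)
      then show ?thesis using X[of n] N by linarith
    qed
    have "dist (X p) (X q) < e" if "p \<ge> N" "q \<ge> N" for p q
    proof -
      have "(norm (X p - X q))\<^sup>2 / 4 < e\<^sup>2 / 4"
        using para[of "X p" "X q"] small[OF that(1)] small[OF that(2)]
          m_le[of "(1/2) *\<^sub>R (X p + X q)"] by linarith
      then have "(norm (X p - X q))\<^sup>2 < e\<^sup>2" by simp
      then show ?thesis using \<open>0 < e\<close> by (simp add: dist_norm power_less_imp_less_base)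
    qed
    then show "\<exists>M. \<forall>p\<ge>M. \<forall>q\<ge>M. dist (X p) (X q) < e" by blast
  qed
  then obtain u where u: "X \<longlonglongrightarrow> u" using Cauchy_convergent convergent_def by blast
  have "(\<lambda>n. J (X n)) \<longlonglongrightarrow> J u"
    unfolding J_def by (intro tendsto_intros u g.tendsto) simp
  moreover have "(\<lambda>n. m + inverse (real (Suc n))) \<longlonglongrightarrow> m + 0"
    by (intro tendsto_intros LIMSEQ_inverse_real_of_nat)
  ultimately have "J u \<le> m + 0"
    by (rule LIMSEQ_le) (use X less_imp_le in blast)
  then have min: "J u \<le> J x" for x using m_le[of x] by linarith
  have "g y = inner y u" for y
  proof -
    define d where "d = inner y u - g y"
    have *: "0 \<le> t * d + t\<^sup>2 * (inner y y / 2)" for t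
      using min[of "u + t *\<^sub>R y"]
      by (simp add: J_def d_def g.scaleR g.add inner_commute inner_add_left inner_add_right
          power2_eq_square algebra_simps add_divide_distrib)
    define s where "s = inner y y + 1"
    have s: "s > 0" "inner y y < s" by (simp_all add: s_def add_nonneg_pos)
    have "0 \<le> (- d / s) * d + (- d / s)\<^sup>2 * (inner y y / 2)" by (rule *)
    also have "\<dots> \<le> (- d / s) * d + (- d / s)\<^sup>2 * (s / 2)"
      using s by (intro add_left_mono mult_left_mono) auto
    also have "\<dots> = - (d\<^sup>2 / (2 * s))"
      using s by (simp add: field_simps power2_eq_square)
    finally have "d\<^sup>2 / (2 * s) \<le> 0" by simp
    then have "d\<^sup>2 \<le> 0" using s by (simp add: divide_le_0_iff)
    then show ?thesis by (simp add: d_def)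
  qed
  then show thesis by (rule that)
qed

lemma cadjoint_exists:
  fixes T :: "'a::chilbert_space \<Rightarrow> 'a"
  assumes "bounded_clinear T"
  shows "\<exists>S. bounded_clinear S \<and> (\<forall>x y. cinner (T x) y = cinner x (S y))"
proof -
  interpret T: bounded_linear T using assms by (simp add: bounded_clinear_def)
  have TC: "T (c *\<^sub>C x) = c *\<^sub>C T x" for c x using assms by (simp add: bounded_clinear_def)
  have "\<exists>u. \<forall>x. cinner (T x) y = cinner x u" for y
  proof -
    have "bounded_linear (\<lambda>x. inner (T x) y)"
      by (rule bounded_linear_compose[OF bounded_linear_inner_left T.bounded_linear_axioms])
    then obtain u where u: "\<And>x. inner (T x) y = inner x u" using riesz_real by blast
    have "cinner (T x) y = cinner x u" for x
    proof (rule complex_eqI)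
      show "Re (cinner (T x) y) = Re (cinner x u)" by (simp add: Re_cinner u)
      have "Re (cinner (T (\<i> *\<^sub>C x)) y) = Re (cinner (\<i> *\<^sub>C x) u)"
        unfolding Re_cinner by (rule u)
      then show "Im (cinner (T x) y) = Im (cinner x u)" by (simp add: TC cinner_scaleC_left)
    qed
    then show ?thesis by blast
  qed
  then obtain S where S: "\<And>x y. cinner (T x) y = cinner x (S y)" by metis
  have add: "S (x + y) = S x + S y" for x y
    by (rule cinner_ext) (simp add: cinner_add_right flip: S)
  have scale: "S (c *\<^sub>C x) = c *\<^sub>C S x" for c x
    by (rule cinner_ext) (simp add: cinner_scaleC_right flip: S)
  obtain K where K: "K > 0" "\<And>x. norm (T x) \<le> norm x * K" using T.pos_bounded by blast
  have bound: "norm (S y) \<le> norm y * K" for y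
  proof (cases "S y = 0")
    case False
    have "norm (S y) * norm (S y) = inner (S y) (S y)"
      by (metis power2_eq_square power2_norm_eq_inner)
    also have "\<dots> = inner (T (S y)) y" by (metis S Re_cinner)
    also have "\<dots> \<le> norm (T (S y)) * norm y" by (rule norm_cauchy_schwarz)
    also have "\<dots> \<le> (norm (S y) * K) * norm y" by (intro mult_right_mono K) simp
    finally have "norm (S y) * norm (S y) \<le> norm (S y) * (norm y * K)" by (simp add: ac_simps)
    then show ?thesis using False by simp
  qed (use K in simp)
  have "bounded_linear S"
    by (rule bounded_linear_intro[OF add _ bound]) (metis scale scaleC_of_real)
  with S scale show ?thesis by (auto simp: bounded_clinear_def)
qed

lemma
  fixes T :: "'a::chilbert_space \<Rightarrow> 'a"
  assumes "bounded_clinear T"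
  shows bounded_clinear_cadjoint: "bounded_clinear (cadjoint T)"
    and cinner_cadjoint: "cinner (T x) y = cinner x (cadjoint T y)"
proof -
  have "\<exists>!S. bounded_clinear S \<and> (\<forall>x y. cinner (T x) y = cinner x (S y))"
  proof (rule ex_ex1I[OF cadjoint_exists[OF assms]])
    fix S S'
    assume "bounded_clinear S \<and> (\<forall>x y. cinner (T x) y = cinner x (S y))"
      and "bounded_clinear S' \<and> (\<forall>x y. cinner (T x) y = cinner x (S' y))"
    then have "cinner x (S y) = cinner x (S' y)" for x y by metis
    then show "S = S'" by (rule ext[OF cinner_ext])
  qed
  from theI'[OF this]
  show "bounded_clinear (cadjoint T)" and "cinner (T x) y = cinner x (cadjoint T y)"
    unfolding cadjoint_def by blast+
qed

end

theory Submission
  imports Defs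
begin

text \<open>
  Both inequalities are obtained by evaluating a combination \<open>\<lambda>\<^sub>1 T + \<lambda>\<^sub>2 T\<^sup>*\<close>, with
  \<open>(\<lambda>\<^sub>1, \<lambda>\<^sub>2)\<close> on the unit sphere of \<open>\<complex>\<^sup>2\<close>, at a single vector \<open>x\<close>.

  For the lower bound let \<open>\<parallel>x\<parallel> = 1\<close> and choose a phase \<open>u\<close> with \<open>u \<langle>Tx, x\<rangle> = |\<langle>Tx, x\<rangle>|\<close>. Since
  \<open>\<langle>T\<^sup>*x, x\<rangle>\<close> is the conjugate of \<open>\<langle>Tx, x\<rangle>\<close>, the choice \<open>\<lambda>\<^sub>1 = u / \<surd>2\<close>, \<open>\<lambda>\<^sub>2 = cnj u / \<surd>2\<close> makes
  the two terms of \<open>\<langle>(\<lambda>\<^sub>1 T + \<lambda>\<^sub>2 T\<^sup>*)x, x\<rangle>\<close> add up to \<open>\<surd>2 |\<langle>Tx, x\<rangle>|\<close>, and this is at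
  most the norm of the combination (\<open>cmod_cinner_le_euclidean_opnorm\<close>).

  For the upper bound, the triangle inequality and the Cauchy--Schwarz inequality in \<open>\<real>\<^sup>2\<close> give
  \<open>\<parallel>\<lambda>\<^sub>1 Tx + \<lambda>\<^sub>2 T\<^sup>*x\<parallel>\<^sup>2 \<le> \<parallel>Tx\<parallel>\<^sup>2 + \<parallel>T\<^sup>*x\<parallel>\<^sup>2 = \<langle>(TT\<^sup>* + T\<^sup>*T)x, x\<rangle>\<close>
  (\<open>onorm_combination_le\<close> and \<open>norm_sum_cadjoint_le\<close>). The same estimate shows that the
  supremum defining the Euclidean norm is over a bounded set, which the lower bound relies on.
\<close>

lemma norm_scaleC: "norm (a *\<^sub>C x) = cmod a * norm (x::'a::complex_inner)"
proof -
  have "complex_of_real ((norm (a *\<^sub>C x))\<^sup>2) = a * cnj a * complex_of_real ((norm x)\<^sup>2)"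
    by (simp only: cinner_self[symmetric] cinner_scaleC_left cinner_scaleC_right mult.assoc
        mult.left_commute[of "cnj a"])
  also have "\<dots> = complex_of_real ((cmod a * norm x)\<^sup>2)"
    by (simp only: complex_norm_square[symmetric] power_mult_distrib of_real_mult)
  finally show ?thesis
    by (simp only: of_real_eq_iff) (simp add: power2_eq_iff_nonneg)
qed

lemma bounded_linear_scaleC: "bounded_linear (\<lambda>x::'a::complex_inner. a *\<^sub>C x)"
proof (rule bounded_linear_intro[where K = "cmod a"])
  fix r and x :: 'a
  show "a *\<^sub>C r *\<^sub>R x = r *\<^sub>R a *\<^sub>C x"
    by (simp add: scaleC_scaleC mult.commute flip: scaleC_of_real)
qed (simp_all add: scaleC_add_right norm_scaleC)

lemma bounded_linear_combination:
  fixes A B :: "'a::complex_inner \<Rightarrow> 'a"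
  assumes "bounded_linear A" "bounded_linear B"
  shows "bounded_linear (\<lambda>x. l\<^sub>1 *\<^sub>C A x + l\<^sub>2 *\<^sub>C B x)"
  by (intro bounded_linear_add bounded_linear_compose[OF bounded_linear_scaleC] assms)

text \<open>
  Cauchy--Schwarz for the moduli of the coefficients against \<open>(\<parallel>Ax\<parallel>, \<parallel>Bx\<parallel>)\<close>. In the
  zero space a negative \<open>M\<close> would satisfy the first hypothesis, although \<open>sqrt M\<close> is then negative;
  hence the separate assumption \<open>M \<ge> 0\<close>.
\<close>

lemma onorm_combination_le:
  fixes A B :: "'a::complex_inner \<Rightarrow> 'a"
  assumes "\<And>x. (norm (A x))\<^sup>2 + (norm (B x))\<^sup>2 \<le> M * (norm x)\<^sup>2" and "M \<ge> 0"
    and l: "(cmod l\<^sub>1)\<^sup>2 + (cmod l\<^sub>2)\<^sup>2 = 1"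
  shows "onorm (\<lambda>x. l\<^sub>1 *\<^sub>C A x + l\<^sub>2 *\<^sub>C B x) \<le> sqrt M"
proof (rule onorm_bound)
  fix x
  have "norm (l\<^sub>1 *\<^sub>C A x + l\<^sub>2 *\<^sub>C B x) \<le> cmod l\<^sub>1 * norm (A x) + cmod l\<^sub>2 * norm (B x)"
    by (metis norm_triangle_ineq norm_scaleC)
  also have "\<dots> \<le> sqrt M * norm x"
  proof (rule power2_le_imp_le)
    have "(cmod l\<^sub>1 * norm (A x) + cmod l\<^sub>2 * norm (B x))\<^sup>2
        \<le> ((cmod l\<^sub>1)\<^sup>2 + (cmod l\<^sub>2)\<^sup>2) * ((norm (A x))\<^sup>2 + (norm (B x))\<^sup>2)"
      using zero_le_power2[of "cmod l\<^sub>1 * norm (B x) - cmod l\<^sub>2 * norm (A x)"]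
      by (simp add: power2_eq_square algebra_simps)
    then show "(cmod l\<^sub>1 * norm (A x) + cmod l\<^sub>2 * norm (B x))\<^sup>2 \<le> (sqrt M * norm x)\<^sup>2"
      using assms(1)[of x] \<open>M \<ge> 0\<close> by (simp add: l power_mult_distrib)
  qed (use \<open>M \<ge> 0\<close> in simp)
  finally show "norm (l\<^sub>1 *\<^sub>C A x + l\<^sub>2 *\<^sub>C B x) \<le> sqrt M * norm x" .
qed (use \<open>M \<ge> 0\<close> in simp)

lemma euclidean_opnorm_le:
  fixes A B :: "'a::complex_inner \<Rightarrow> 'a"
  assumes "\<And>x. (norm (A x))\<^sup>2 + (norm (B x))\<^sup>2 \<le> M * (norm x)\<^sup>2" and "M \<ge> 0"
  shows "euclidean_opnorm A B \<le> sqrt M"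
  unfolding euclidean_opnorm_def
proof (rule cSup_least)
  have "(cmod 1)\<^sup>2 + (cmod 0)\<^sup>2 = 1" by simp
  then show "{onorm (\<lambda>x. l\<^sub>1 *\<^sub>C A x + l\<^sub>2 *\<^sub>C B x) | l\<^sub>1 l\<^sub>2. (cmod l\<^sub>1)\<^sup>2 + (cmod l\<^sub>2)\<^sup>2 = 1} \<noteq> {}"
    by blast
qed (use onorm_combination_le[OF assms] in blast)

text \<open>
  A supremum of reals dominates its members only when the set is bounded above; the bound comes
  from \<open>onorm_combination_le\<close> with \<open>M = \<parallel>A\<parallel>\<^sup>2 + \<parallel>B\<parallel>\<^sup>2\<close>.
\<close>

lemma onorm_combination_le_euclidean_opnorm:
  fixes A B :: "'a::complex_inner \<Rightarrow> 'a"
  assumes "bounded_linear A" "bounded_linear B" "(cmod l\<^sub>1)\<^sup>2 + (cmod l\<^sub>2)\<^sup>2 = 1"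
  shows "onorm (\<lambda>x. l\<^sub>1 *\<^sub>C A x + l\<^sub>2 *\<^sub>C B x) \<le> euclidean_opnorm A B"
  unfolding euclidean_opnorm_def
proof (rule cSup_upper)
  have sq: "(norm (F x))\<^sup>2 \<le> (onorm F)\<^sup>2 * (norm x)\<^sup>2" if "bounded_linear F" for F :: "'a \<Rightarrow> 'a" and x
    using power_mono[OF onorm[OF that, of x], of 2] by (simp add: power_mult_distrib)
  have "(norm (A x))\<^sup>2 + (norm (B x))\<^sup>2 \<le> ((onorm A)\<^sup>2 + (onorm B)\<^sup>2) * (norm x)\<^sup>2" for x
    using sq[OF assms(1), of x] sq[OF assms(2), of x] by (simp add: algebra_simps)
  from onorm_combination_le[OF this]
  show "bdd_above {onorm (\<lambda>x. l\<^sub>1 *\<^sub>C A x + l\<^sub>2 *\<^sub>C B x) | l\<^sub>1 l\<^sub>2. (cmod l\<^sub>1)\<^sup>2 + (cmod l\<^sub>2)\<^sup>2 = 1}"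
    unfolding bdd_above_def by (smt (verit) mem_Collect_eq zero_le_power2)
qed (use assms(3) in blast)

lemma exists_phase: "\<exists>u. cmod u = 1 \<and> u * z = complex_of_real (cmod z)"
proof (cases "z = 0")
  case True
  then show ?thesis by (intro exI[of _ 1]) simp
next
  case False
  then have "cmod (cnj z / cmod z) = 1" by (simp add: norm_divide)
  moreover have "cnj z / cmod z * z = cmod z"
    using False by (simp add: field_simps power2_eq_square flip: complex_norm_square)
  ultimately show ?thesis by blast
qed

lemma cinner_cadjoint_left:
  fixes T :: "'a::chilbert_space \<Rightarrow> 'a"
  assumes "bounded_clinear T"
  shows "cinner (cadjoint T x) y = cinner x (T y)"
  by (metis assms cinner_cadjoint cinner_commute)

text \<open>
  The coefficients \<open>u / \<surd>2\<close> and \<open>cnj u / \<surd>2\<close>, with \<open>u\<close> the phase that rotates \<open>\<langle>Tx, x\<rangle>\<close> onto the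
  nonnegative real axis, turn the combination into \<open>\<surd>2\<close> times the real part of \<open>uT\<close>.
\<close>

lemma cmod_cinner_le_euclidean_opnorm:
  fixes T :: "'a::chilbert_space \<Rightarrow> 'a"
  assumes T: "bounded_clinear T" and x: "norm x = 1"
  shows "sqrt 2 * cmod (cinner (T x) x) \<le> euclidean_opnorm T (cadjoint T)"
proof -
  define z where "z = cinner (T x) x"
  obtain u where u: "cmod u = 1" "u * z = complex_of_real (cmod z)"
    using exists_phase by blast
  define a where "a = u / complex_of_real (sqrt 2)"
  define S where "S = (\<lambda>x. a *\<^sub>C T x + cnj a *\<^sub>C cadjoint T x)"
  have bl: "bounded_linear T" "bounded_linear (cadjoint T)"
    using T bounded_clinear_cadjoint[OF T] by (simp_all add: bounded_clinear_def)
  have unit: "(cmod a)\<^sup>2 + (cmod (cnj a))\<^sup>2 = 1"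
    by (simp add: a_def norm_divide u power_divide)
  have "a * z = complex_of_real (cmod z / sqrt 2)"
    by (simp add: a_def u)
  have "cinner (cadjoint T x) x = cnj z"
    by (simp add: cinner_cadjoint_left[OF T] z_def flip: cinner_commute)
  then have "inner (S x) x = Re (a * z + cnj (a * z))"
    by (simp add: S_def cinner_add_left cinner_scaleC_left z_def flip: Re_cinner)
  also have "\<dots> = 2 * (cmod z / sqrt 2)"
    unfolding \<open>a * z = _\<close> by simp
  also have "\<dots> = sqrt 2 * cmod z"
    by (simp add: real_div_sqrt field_simps)
  finally have "sqrt 2 * cmod z = inner (S x) x" ..
  also have "\<dots> \<le> norm (S x)"
    using norm_cauchy_schwarz[of "S x" x] x by simp
  also have "\<dots> \<le> onorm S"
    using onorm[of S x] bounded_linear_combination[OF bl] x by (simp add: S_def)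
  also have "\<dots> \<le> euclidean_opnorm T (cadjoint T)"
    unfolding S_def by (rule onorm_combination_le_euclidean_opnorm[OF bl unit])
  finally show ?thesis by (simp add: z_def)
qed

text \<open>The left-hand side is \<open>\<langle>(TT\<^sup>* + T\<^sup>*T)x, x\<rangle>\<close>.\<close>

lemma norm_sum_cadjoint_le:
  fixes T :: "'a::chilbert_space \<Rightarrow> 'a"
  assumes T: "bounded_clinear T"
  shows "(norm (T x))\<^sup>2 + (norm (cadjoint T x))\<^sup>2
    \<le> onorm (\<lambda>x. T (cadjoint T x) + cadjoint T (T x)) * (norm x)\<^sup>2"
proof -
  define P where "P = (\<lambda>x. T (cadjoint T x) + cadjoint T (T x))"
  have bl: "bounded_linear T" "bounded_linear (cadjoint T)"
    using T bounded_clinear_cadjoint[OF T] by (simp_all add: bounded_clinear_def)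
  have P: "bounded_linear P"
    unfolding P_def by (intro bounded_linear_add bounded_linear_compose[OF bl(1)]
        bounded_linear_compose[OF bl(2)] bl)
  have "inner (P x) x = (norm (T x))\<^sup>2 + (norm (cadjoint T x))\<^sup>2"
    by (simp add: P_def cinner_add_left cinner_cadjoint[OF T] cinner_cadjoint_left[OF T]
        cinner_self flip: Re_cinner)
  moreover have "inner (P x) x \<le> norm (P x) * norm x"
    by (rule norm_cauchy_schwarz)
  moreover have "norm (P x) * norm x \<le> onorm P * norm x * norm x"
    by (intro mult_right_mono onorm[OF P]) simp
  ultimately show ?thesis
    unfolding P_def[symmetric] by (simp add: power2_eq_square mult.assoc)
qed

theorem corollary2p1:
  fixes T :: "'a::chilbert_space \<Rightarrow> 'a"
  assumes "bounded_clinear T"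
  shows "(numerical_radius T)\<^sup>2 \<le> 1 / 2 * (euclidean_opnorm T (cadjoint T))\<^sup>2
    \<and> 1 / 2 * (euclidean_opnorm T (cadjoint T))\<^sup>2
        \<le> 1 / 2 * onorm (\<lambda>x. T (cadjoint T x) + cadjoint T (T x))"
proof -
  define E where "E = euclidean_opnorm T (cadjoint T)"
  define M where "M = onorm (\<lambda>x. T (cadjoint T x) + cadjoint T (T x))"
  have bl: "bounded_linear T" "bounded_linear (cadjoint T)"
    using assms bounded_clinear_cadjoint[OF assms] by (simp_all add: bounded_clinear_def)
  have "0 \<le> onorm (\<lambda>x. 1 *\<^sub>C T x + 0 *\<^sub>C cadjoint T x)"
    by (rule onorm_pos_le[OF bounded_linear_combination[OF bl]])
  also have "\<dots> \<le> E"
    unfolding E_def by (rule onorm_combination_le_euclidean_opnorm[OF bl]) simp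
  finally have "0 \<le> E" .
  have "bounded_linear (\<lambda>x. T (cadjoint T x) + cadjoint T (T x))"
    by (intro bounded_linear_add bounded_linear_compose[OF bl(1)]
        bounded_linear_compose[OF bl(2)] bl)
  then have "0 \<le> M"
    unfolding M_def by (rule onorm_pos_le)
  let ?W = "insert 0 {cmod (cinner (T x) x) | x. norm x = 1}"
  have bound: "w \<le> E / sqrt 2" if "w \<in> ?W" for w
    using that cmod_cinner_le_euclidean_opnorm[OF assms] \<open>0 \<le> E\<close>
    by (auto simp: E_def field_simps)
  then have le: "numerical_radius T \<le> E / sqrt 2"
    unfolding numerical_radius_def by (intro cSup_least) auto
  have "0 \<le> numerical_radius T"
    unfolding numerical_radius_def using bound
    by (intro cSup_upper) (auto simp only: bdd_above_def insert_iff)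
  then have "(numerical_radius T)\<^sup>2 \<le> (E / sqrt 2)\<^sup>2"
    using le by (intro power_mono)
  then have lower: "(numerical_radius T)\<^sup>2 \<le> 1 / 2 * E\<^sup>2"
    by (simp add: power_divide)
  have "E \<le> sqrt M"
    unfolding E_def using norm_sum_cadjoint_le[OF assms] \<open>0 \<le> M\<close>
    by (intro euclidean_opnorm_le) (simp_all add: M_def)
  then have "E\<^sup>2 \<le> M"
    using \<open>0 \<le> E\<close> \<open>0 \<le> M\<close> power_mono[of E "sqrt M" 2] by simp
  with lower show ?thesis
    by (simp add: E_def M_def)
qed

end
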